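(* Let $(X,\exp)$ be an injective geodesic structure and let $M$ be a connected $(X,\exp)$-geodesic manifold with universal cover $\widetilde M$. Suppose that for $p\in\widetilde M$ the visible set satisfies $V_p=T_p\widetilde M$. Then $V_p$ is convex.
   Context: Geodesic structure. Let $X$ be a smooth manifold and $\exp\colon TX\to X$ a smooth map such that for every $x\in X$ the restriction $\exp_x\colon T_xX\to X$ is a surjective open map and a local diffeomorphism around $0\in T_xX$. A geodesic segment of $X$ is a curve $\gamma\colon[0,1]\to X$ such that $\gamma(t)=\exp_x(tv)$ with $x=\gamma(0)$ and $v\in T_xX$. A subset $C\subset X$ is convex if: (a) for every pair of points $(x,y)$ of $C$ there is a geodesic segment from $x$ to $y$ fully contained in $C$; (b) for any sequence $(\gamma_n)$ of geodesic segments all based at the same $p\in C$ (i.e. $\gamma_n(0)=p$), if $\gamma_n(1)$ tends to $q\in\overline C$, then a subsequence of $(\gamma_n)$ tends to a geodesic segment $\gamma$ from $p$ to $q$ such that $\gamma(t)\in C$ for $t<1$. The pair $(X,\exp)$ is a geodesic structure if moreover: (1) for $x\in X$, $u\in T_xX$, $0\le s<1$ and $y=\exp_x(su)$, there exists $v\in T_yX$ such that $\exp_y(tv)=\exp_x((s+t)u)$ for any $0\le t<1-s$; (2) $X$ is locally convex: every neighborhood of any $x\in X$ contains an open convex subset containing $x$. The geodesic structure is injective if for any pair $(x,y)\in X\times X$ there exists a unique geodesic segment from $x$ to $y$. Geodesic manifold. A connected smooth manifold $M$ with universal cover $\widetilde M$ is an $(X,\exp)$-geodesic manifold if there is a local diffeomorphism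 $D\colon\widetilde M\to X$, called the developing map. A geodesic segment in $\widetilde M$ is a smooth curve $\gamma\colon[0,1]\to\widetilde M$ such that $D\circ\gamma$ is a geodesic segment of $X$; if $D(\gamma(t))=\exp_{D(\gamma(0))}(tu)$, its initial vector is $v=(dD_{\gamma(0)})^{-1}(u)$ and one writes $\gamma(t)=\exp_{\gamma(0)}(tv)$. The visible set $V_p\subset T_p\widetilde M$ is the maximal star-shaped neighborhood of $0$ on which $\exp_p$ is well defined, i.e. the set of $v$ that are initial vectors of geodesic segments $[0,1]\to\widetilde M$ based at $p$. A subset $C\subset\widetilde M$ is convex if $D(C)$ is convex in $X$ and $D|_C$ is injective. A subset $C_p\subset V_p$ is convex if $\exp_p(C_p)\subset\widetilde M$ is convex. *)

theory Defs
  imports "HOL-Analysis.Analysis"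
begin

section \<open>Smooth maps between open subsets of normed spaces\<close>

text \<open>On an open set of a finite-dimensional space this is membership in the class of
  \<open>k\<close> times continuously differentiable maps.\<close>

primrec times_cont_diff_on ::
  "nat \<Rightarrow> 'a::real_normed_vector set \<Rightarrow> ('a \<Rightarrow> 'b::real_normed_vector) \<Rightarrow> bool" where
  "times_cont_diff_on 0 W f \<longleftrightarrow> continuous_on W f"
| "times_cont_diff_on (Suc k) W f \<longleftrightarrow>
     (\<forall>x\<in>W. f differentiable (at x)) \<and>
     (\<forall>h. times_cont_diff_on k W (\<lambda>x. frechet_derivative f (at x) h))"

definition smooth_on :: "'a::real_normed_vector set \<Rightarrow> ('a \<Rightarrow> 'b::real_normed_vector) \<Rightarrow> bool" where
  "smooth_on W f \<longleftrightarrow> open W \<and> (\<forall>k. times_cont_diff_on k W f)"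

section \<open>Smooth manifolds\<close>

text \<open>A chart is a pair \<open>(U, \<phi>)\<close>; the values of \<open>\<phi>\<close> outside \<open>U\<close> are irrelevant.\<close>

type_synonym ('a, 'e) chart = "'a set \<times> ('a \<Rightarrow> 'e)"

definition chart_inv :: "('a, 'e) chart \<Rightarrow> 'e \<Rightarrow> 'a" where
  "chart_inv c = inv_into (fst c) (snd c)"

definition local_rep :: "('a, 'e) chart \<Rightarrow> ('b, 'f) chart \<Rightarrow> ('a \<Rightarrow> 'b) \<Rightarrow> 'e \<Rightarrow> 'f" where
  "local_rep c d f = snd d \<circ> f \<circ> chart_inv c"

text \<open>The model space is any finite-dimensional real normed space, the zero space included.\<close>

definition smooth_manifold ::
  "('a::{t2_space,second_countable_topology}, 'e::real_normed_vector) chart set \<Rightarrow> bool" where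
  "smooth_manifold A \<longleftrightarrow>
     (\<exists>B::'e set. finite B \<and> span B = UNIV) \<and>
     (\<Union>c\<in>A. fst c) = UNIV \<and>
     (\<forall>c\<in>A. open (fst c) \<and> open (snd c ` fst c) \<and>
        homeomorphism (fst c) (snd c ` fst c) (snd c) (chart_inv c)) \<and>
     (\<forall>c\<in>A. \<forall>d\<in>A. smooth_on (snd c ` (fst c \<inter> fst d)) (local_rep c d id))"

text \<open>The topology defined by an atlas. It is needed for tangent spaces, whose points have a
  function type; for the atlas of a \<open>smooth_manifold\<close> it is the topology of the type.\<close>

definition atlas_topology :: "('a, 'e::topological_space) chart set \<Rightarrow> 'a topology" where
  "atlas_topology A = topology_generated_by {fst c \<inter> snd c -` W | c W. c \<in> A \<and> open W}"

definition smooth_at ::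
  "('a, 'e::real_normed_vector) chart set \<Rightarrow> ('b, 'f::real_normed_vector) chart set \<Rightarrow>
    ('a \<Rightarrow> 'b) \<Rightarrow> 'a \<Rightarrow> bool" where
  "smooth_at A B f x \<longleftrightarrow>
     (\<exists>c\<in>A. \<exists>d\<in>B. \<exists>W. x \<in> fst c \<and> snd c x \<in> W \<and> W \<subseteq> snd c ` fst c \<and>
        f ` chart_inv c ` W \<subseteq> fst d \<and> smooth_on W (local_rep c d f))"

definition local_diffeo_at ::
  "('a, 'e::real_normed_vector) chart set \<Rightarrow> ('b, 'f::real_normed_vector) chart set \<Rightarrow>
    ('a \<Rightarrow> 'b) \<Rightarrow> 'a \<Rightarrow> bool" where
  "local_diffeo_at A B f x \<longleftrightarrow>
     (\<exists>U V. openin (atlas_topology A) U \<and> x \<in> U \<and> openin (atlas_topology B) V \<and>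
        bij_betw f U V \<and>
        (\<forall>y\<in>U. smooth_at A B f y) \<and> (\<forall>z\<in>V. smooth_at B A (inv_into U f) z))"

text \<open>Smoothness on \<open>[0,1]\<close>: near each parameter, including the endpoints, the curve is the
  restriction of a smooth curve defined on an open interval.\<close>

definition smooth_curve :: "('a, 'e::real_normed_vector) chart set \<Rightarrow> (real \<Rightarrow> 'a) \<Rightarrow> bool" where
  "smooth_curve A \<gamma> \<longleftrightarrow>
     (\<forall>s\<in>{0..1}. \<exists>c\<in>A. \<exists>W h. s \<in> W \<and> smooth_on W h \<and>
        (\<forall>t\<in>W \<inter> {0..1}. \<gamma> t \<in> fst c \<and> snd c (\<gamma> t) = h t))"

section \<open>Tangent vectors\<close>

text \<open>A tangent vector at \<open>x\<close> is a family of coordinate vectors, one for each chart at \<open>x\<close>, that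
  transforms by the derivatives of the changes of charts. It is set to zero on all other pairs, so
  that the vector space operations are pointwise.\<close>

type_synonym ('a, 'e) tvec = "('a, 'e) chart \<Rightarrow> 'e"

definition tangent_space ::
  "('a, 'e::real_normed_vector) chart set \<Rightarrow> 'a \<Rightarrow> ('a, 'e) tvec set" where
  "tangent_space A x = {v.
     (\<forall>c. \<not> (c \<in> A \<and> x \<in> fst c) \<longrightarrow> v c = 0) \<and>
     (\<forall>c\<in>A. \<forall>d\<in>A. x \<in> fst c \<inter> fst d \<longrightarrow>
        v d = frechet_derivative (local_rep c d id) (at (snd c x)) (v c))}"

definition tzero :: "('a, 'e::real_normed_vector) tvec" where
  "tzero = (\<lambda>c. 0)"

definition tscale :: "real \<Rightarrow> ('a, 'e::real_normed_vector) tvec \<Rightarrow> ('a, 'e) tvec" where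
  "tscale t v = (\<lambda>c. t *\<^sub>R v c)"

definition tangent_space_atlas ::
  "('a, 'e::real_normed_vector) chart set \<Rightarrow> 'a \<Rightarrow> (('a, 'e) tvec, 'e) chart set" where
  "tangent_space_atlas A x = {(tangent_space A x, \<lambda>v. v c) | c. c \<in> A \<and> x \<in> fst c}"

definition tangent_bundle ::
  "('a, 'e::real_normed_vector) chart set \<Rightarrow> ('a \<times> ('a, 'e) tvec) set" where
  "tangent_bundle A = (SIGMA x:UNIV. tangent_space A x)"

definition tangent_bundle_atlas ::
  "('a, 'e::real_normed_vector) chart set \<Rightarrow> ('a \<times> ('a, 'e) tvec, 'e \<times> 'e) chart set" where
  "tangent_bundle_atlas A =
     {(SIGMA x:fst c. tangent_space A x, \<lambda>(x, v). (snd c x, v c)) | c. c \<in> A}"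

text \<open>The differential of \<open>f\<close> at \<open>x\<close>. By the chain rule the choice of the chart at \<open>x\<close> does
  not matter when \<open>f\<close> is smooth at \<open>x\<close> and \<open>v\<close> is a tangent vector at \<open>x\<close>.\<close>

definition differential ::
  "('a, 'e::real_normed_vector) chart set \<Rightarrow> ('b, 'f::real_normed_vector) chart set \<Rightarrow>
    ('a \<Rightarrow> 'b) \<Rightarrow> 'a \<Rightarrow> ('a, 'e) tvec \<Rightarrow> ('b, 'f) tvec" where
  "differential A B f x v = (\<lambda>d.
     if d \<in> B \<and> f x \<in> fst d
     then let c = (SOME c. c \<in> A \<and> x \<in> fst c)
          in frechet_derivative (local_rep c d f) (at (snd c x)) (v c)
     else 0)"

section \<open>Geodesic structures\<close>

text \<open>The exponential map is curried: \<open>Exp x v\<close> is \<open>exp\<^sub>x(v)\<close>, and only its values for \<open>v\<close> in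
  the tangent space at \<open>x\<close> matter. Curves are functions on \<open>real\<close> of which only the restriction
  to \<open>[0,1]\<close> matters.\<close>

definition geodesic_segment ::
  "('x, 'e::real_normed_vector) chart set \<Rightarrow> ('x \<Rightarrow> ('x, 'e) tvec \<Rightarrow> 'x) \<Rightarrow> (real \<Rightarrow> 'x) \<Rightarrow> bool" where
  "geodesic_segment A Exp \<gamma> \<longleftrightarrow>
     (\<exists>v\<in>tangent_space A (\<gamma> 0). \<forall>t\<in>{0..1}. \<gamma> t = Exp (\<gamma> 0) (tscale t v))"

text \<open>Convergence in the compact-open topology on the curves \<open>[0,1] \<rightarrow> X\<close>, which is uniform
  convergence for any metric inducing the topology of \<open>X\<close>.\<close>

definition curves_converge :: "(nat \<Rightarrow> real \<Rightarrow> 'x::topological_space) \<Rightarrow> (real \<Rightarrow> 'x) \<Rightarrow> bool" where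
  "curves_converge g \<gamma> \<longleftrightarrow>
     (\<forall>K U. compact K \<and> K \<subseteq> {0..1} \<and> open U \<and> \<gamma> ` K \<subseteq> U \<longrightarrow>
        (\<forall>\<^sub>F n in sequentially. g n ` K \<subseteq> U))"

definition geodesically_convex ::
  "('x::topological_space, 'e::real_normed_vector) chart set \<Rightarrow>
    ('x \<Rightarrow> ('x, 'e) tvec \<Rightarrow> 'x) \<Rightarrow> 'x set \<Rightarrow> bool" where
  "geodesically_convex A Exp C \<longleftrightarrow>
     (\<forall>x\<in>C. \<forall>y\<in>C. \<exists>\<gamma>. geodesic_segment A Exp \<gamma> \<and> \<gamma> 0 = x \<and> \<gamma> 1 = y \<and> \<gamma> ` {0..1} \<subseteq> C) \<and>
     (\<forall>p\<in>C. \<forall>q\<in>closure C. \<forall>g::nat \<Rightarrow> real \<Rightarrow> 'x.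
        (\<forall>n. geodesic_segment A Exp (g n) \<and> g n 0 = p) \<and> (\<lambda>n. g n 1) \<longlonglongrightarrow> q \<longrightarrow>
        (\<exists>r \<gamma>. strict_mono r \<and> curves_converge (g \<circ> r) \<gamma> \<and>
           geodesic_segment A Exp \<gamma> \<and> \<gamma> 0 = p \<and> \<gamma> 1 = q \<and> (\<forall>t\<in>{0..<1}. \<gamma> t \<in> C)))"

definition geodesic_structure ::
  "('x::{t2_space,second_countable_topology}, 'e::real_normed_vector) chart set \<Rightarrow>
    ('x \<Rightarrow> ('x, 'e) tvec \<Rightarrow> 'x) \<Rightarrow> bool" where
  "geodesic_structure A Exp \<longleftrightarrow>
     smooth_manifold A \<and>
     (\<forall>w\<in>tangent_bundle A. smooth_at (tangent_bundle_atlas A) A (\<lambda>(x, v). Exp x v) w) \<and>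
     (\<forall>x. Exp x ` tangent_space A x = UNIV \<and>
          open_map (atlas_topology (tangent_space_atlas A x)) euclidean (Exp x) \<and>
          local_diffeo_at (tangent_space_atlas A x) A (Exp x) tzero) \<and>
     (\<forall>x. \<forall>u\<in>tangent_space A x. \<forall>s y. 0 \<le> s \<and> s < 1 \<and> y = Exp x (tscale s u) \<longrightarrow>
        (\<exists>v\<in>tangent_space A y. \<forall>t. 0 \<le> t \<and> t < 1 - s \<longrightarrow>
           Exp y (tscale t v) = Exp x (tscale (s + t) u))) \<and>
     (\<forall>x N. x \<in> interior N \<longrightarrow> (\<exists>C. open C \<and> x \<in> C \<and> C \<subseteq> N \<and> geodesically_convex A Exp C))"

definition injective_geodesic_structure ::
  "('x::{t2_space,second_countable_topology}, 'e::real_normed_vector) chart set \<Rightarrow>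
    ('x \<Rightarrow> ('x, 'e) tvec \<Rightarrow> 'x) \<Rightarrow> bool" where
  "injective_geodesic_structure A Exp \<longleftrightarrow>
     geodesic_structure A Exp \<and>
     (\<forall>x y. \<exists>\<gamma>. (geodesic_segment A Exp \<gamma> \<and> \<gamma> 0 = x \<and> \<gamma> 1 = y) \<and>
        (\<forall>\<gamma>'. geodesic_segment A Exp \<gamma>' \<and> \<gamma>' 0 = x \<and> \<gamma>' 1 = y \<longrightarrow>
           (\<forall>t\<in>{0..1}. \<gamma>' t = \<gamma> t)))"

section \<open>Geodesic manifolds\<close>

definition universal_cover ::
  "('m::{t2_space,second_countable_topology}, 'f::real_normed_vector) chart set \<Rightarrow>
    ('u::{t2_space,second_countable_topology}, 'f) chart set \<Rightarrow> ('u \<Rightarrow> 'm) \<Rightarrow> bool" where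
  "universal_cover M M' \<pi> \<longleftrightarrow>
     smooth_manifold M' \<and> simply_connected (UNIV :: 'u set) \<and>
     covering_space UNIV \<pi> UNIV \<and> (\<forall>z. local_diffeo_at M' M \<pi> z)"

text \<open>The variables \<open>A\<close>, \<open>M\<close>, \<open>M'\<close> are the atlases of \<open>X\<close>, of the manifold and of its
  universal cover, \<open>\<pi>\<close> is the covering map and \<open>D\<close> the developing map.\<close>

definition geodesic_manifold ::
  "('x::{t2_space,second_countable_topology}, 'e::real_normed_vector) chart set \<Rightarrow>
    ('m::{t2_space,second_countable_topology}, 'f::real_normed_vector) chart set \<Rightarrow>
    ('u::{t2_space,second_countable_topology}, 'f) chart set \<Rightarrow>
    ('u \<Rightarrow> 'm) \<Rightarrow> ('u \<Rightarrow> 'x) \<Rightarrow> bool" where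
  "geodesic_manifold A M M' \<pi> D \<longleftrightarrow>
     smooth_manifold M \<and> connected (UNIV :: 'm set) \<and>
     universal_cover M M' \<pi> \<and> (\<forall>z. local_diffeo_at M' A D z)"

definition cover_geodesic_segment ::
  "('x, 'e::real_normed_vector) chart set \<Rightarrow> ('x \<Rightarrow> ('x, 'e) tvec \<Rightarrow> 'x) \<Rightarrow>
    ('u, 'f::real_normed_vector) chart set \<Rightarrow> ('u \<Rightarrow> 'x) \<Rightarrow> (real \<Rightarrow> 'u) \<Rightarrow> bool" where
  "cover_geodesic_segment A Exp M' D \<gamma> \<longleftrightarrow>
     smooth_curve M' \<gamma> \<and> geodesic_segment A Exp (D \<circ> \<gamma>)"

text \<open>The equation \<open>differential M' A D (\<gamma> 0) v = u\<close> is \<open>v = (dD)\<^sup>-\<^sup>1(u)\<close>, the differential being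
  an isomorphism of tangent spaces.\<close>

definition initial_vector ::
  "('x, 'e::real_normed_vector) chart set \<Rightarrow> ('x \<Rightarrow> ('x, 'e) tvec \<Rightarrow> 'x) \<Rightarrow>
    ('u, 'f::real_normed_vector) chart set \<Rightarrow> ('u \<Rightarrow> 'x) \<Rightarrow>
    (real \<Rightarrow> 'u) \<Rightarrow> ('u, 'f) tvec \<Rightarrow> bool" where
  "initial_vector A Exp M' D \<gamma> v \<longleftrightarrow>
     v \<in> tangent_space M' (\<gamma> 0) \<and>
     (\<exists>u\<in>tangent_space A (D (\<gamma> 0)).
        (\<forall>t\<in>{0..1}. D (\<gamma> t) = Exp (D (\<gamma> 0)) (tscale t u)) \<and>
        differential M' A D (\<gamma> 0) v = u)"

definition visible_set ::
  "('x, 'e::real_normed_vector) chart set \<Rightarrow> ('x \<Rightarrow> ('x, 'e) tvec \<Rightarrow> 'x) \<Rightarrow>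
    ('u, 'f::real_normed_vector) chart set \<Rightarrow> ('u \<Rightarrow> 'x) \<Rightarrow> 'u \<Rightarrow> ('u, 'f) tvec set" where
  "visible_set A Exp M' D p =
     {v. \<exists>\<gamma>. cover_geodesic_segment A Exp M' D \<gamma> \<and> \<gamma> 0 = p \<and> initial_vector A Exp M' D \<gamma> v}"

text \<open>For \<open>v\<close> in the visible set at \<open>p\<close> the segment is unique on \<open>[0,1]\<close>, because \<open>D\<close> is a local
  homeomorphism on a Hausdorff space, so the choice is only formal.\<close>

definition cover_exp ::
  "('x, 'e::real_normed_vector) chart set \<Rightarrow> ('x \<Rightarrow> ('x, 'e) tvec \<Rightarrow> 'x) \<Rightarrow>
    ('u, 'f::real_normed_vector) chart set \<Rightarrow> ('u \<Rightarrow> 'x) \<Rightarrow> 'u \<Rightarrow> ('u, 'f) tvec \<Rightarrow> 'u" where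
  "cover_exp A Exp M' D p v =
     (SOME \<gamma>. cover_geodesic_segment A Exp M' D \<gamma> \<and> \<gamma> 0 = p \<and> initial_vector A Exp M' D \<gamma> v) 1"

definition cover_convex ::
  "('x::topological_space, 'e::real_normed_vector) chart set \<Rightarrow>
    ('x \<Rightarrow> ('x, 'e) tvec \<Rightarrow> 'x) \<Rightarrow> ('u \<Rightarrow> 'x) \<Rightarrow> 'u set \<Rightarrow> bool" where
  "cover_convex A Exp D C \<longleftrightarrow> geodesically_convex A Exp (D ` C) \<and> inj_on D C"

definition visible_convex ::
  "('x::topological_space, 'e::real_normed_vector) chart set \<Rightarrow>
    ('x \<Rightarrow> ('x, 'e) tvec \<Rightarrow> 'x) \<Rightarrow> ('u, 'f::real_normed_vector) chart set \<Rightarrow> ('u \<Rightarrow> 'x) \<Rightarrow>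
    'u \<Rightarrow> ('u, 'f) tvec set \<Rightarrow> bool" where
  "visible_convex A Exp M' D p C \<longleftrightarrow>
     C \<subseteq> visible_set A Exp M' D p \<and> cover_convex A Exp D (cover_exp A Exp M' D p ` C)"

end

theory Submission
  imports Defs
begin

text \<open>Developing conjugates the exponential map at \<open>p\<close> to the exponential map of \<open>X\<close> at
  \<open>x = D p\<close>: on the visible set, \<open>D \<circ> exp\<^sub>p = exp\<^sub>x \<circ> dD\<^sub>p\<close>
  (\<open>visible_set_develops\<close>). When the visible set is the whole tangent space, both maps on the
  right are bijective. For \<open>dD\<^sub>p\<close> this holds because \<open>D\<close> is a local diffeomorphism
  (\<open>differential_bij_betw\<close>). For \<open>exp\<^sub>x\<close>, surjectivity is part of a geodesic structure;
  two vectors with the same image give two segments with the same endpoints, which coincide by the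
  injectivity of the structure, and then the vectors agree because \<open>exp\<^sub>x\<close> is injective near
  \<open>0\<close> (\<open>inj_on_Exp\<close>). Hence \<open>D\<close> maps the image of the visible set bijectively onto all of
  \<open>X\<close>, and it remains to see that \<open>X\<close> itself is convex.

  The first condition of convexity, the existence of segments, is given. The second asks that
  segments from a fixed point whose endpoints converge have a convergent subsequence. The whole
  sequence converges: for every \<open>x\<close> the map \<open>exp\<^sub>x\<close> is a continuous open bijection, so convergence of the endpoints
  \<open>exp\<^sub>x(w\<^sub>n)\<close> forces convergence of the initial vectors \<open>w\<^sub>n\<close>, and the segments
  \<open>t \<mapsto> exp\<^sub>x(tw\<^sub>n)\<close> then converge uniformly because \<open>exp\<^sub>x\<close> is continuous and
  \<open>[0,1]\<close> is compact (\<open>geodesic_segments_converge\<close>).\<close>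

section \<open>Smooth maps in charts\<close>

lemma smooth_onD:
  assumes "smooth_on W f"
  shows "open W" "continuous_on W f" "\<And>z. z \<in> W \<Longrightarrow> f differentiable (at z)"
proof -
  have k: "times_cont_diff_on k W f" for k
    using assms by (simp add: smooth_on_def)
  show "open W" using assms by (simp add: smooth_on_def)
  show "continuous_on W f" using k[of 0] by simp
  show "f differentiable (at z)" if "z \<in> W" for z using k[of "Suc 0"] that by simp
qed

lemma
  assumes "smooth_manifold A" "c \<in> A"
  shows open_chart_domain: "open (fst c)"
    and open_chart_image: "open (snd c ` fst c)"
    and continuous_on_chart: "continuous_on (fst c) (snd c)"
    and continuous_on_chart_inv: "continuous_on (snd c ` fst c) (chart_inv c)"
    and chart_inv_chart: "x \<in> fst c \<Longrightarrow> chart_inv c (snd c x) = x"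
  using assms unfolding smooth_manifold_def homeomorphism_def by auto

lemma manifold_chart_exists:
  assumes "smooth_manifold A"
  obtains c where "c \<in> A" "x \<in> fst c"
  using assms unfolding smooth_manifold_def by blast

lemma
  assumes "smooth_manifold A" "c \<in> A" "x \<in> fst c"
  shows isCont_chart: "isCont (snd c) x"
    and isCont_chart_inv: "isCont (chart_inv c) (snd c x)"
  using assms continuous_on_chart continuous_on_chart_inv open_chart_domain open_chart_image
    continuous_on_eq_continuous_at
  by blast+

lemma eventually_chart_inv:
  assumes A: "smooth_manifold A" "c \<in> A" "x \<in> fst c" and P: "eventually P (nhds x)"
  shows "\<forall>\<^sub>F z in nhds (snd c x).
    P (chart_inv c z) \<and> chart_inv c z \<in> fst c \<and> snd c (chart_inv c z) = z"
proof -
  have "filterlim (chart_inv c) (nhds x) (nhds (snd c x))"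
    using isCont_chart_inv[OF A] tendsto_at_iff_tendsto_nhds[of "chart_inv c" "snd c x"]
    by (simp add: isCont_def chart_inv_chart[OF A])
  then have "\<forall>\<^sub>F z in nhds (snd c x). P (chart_inv c z)"
    using P by (simp add: filterlim_iff)
  moreover have "\<forall>\<^sub>F z in nhds (snd c x). z \<in> snd c ` fst c"
    using open_chart_image[OF A(1,2)] A(3) by (auto intro: eventually_nhds_in_open)
  ultimately show ?thesis
    by eventually_elim (auto simp: chart_inv_chart[OF A(1,2)])
qed

text \<open>A smooth map is continuous for the topology that the charts define on the source. This is
  formulated by convergence in the charts because the source may be a tangent bundle, whose type
  carries no topology.\<close>

lemma smooth_at_tendsto:
  assumes f: "smooth_at A B f x" and B: "smooth_manifold B"
    and inj: "\<And>c. c \<in> A \<Longrightarrow> x \<in> fst c \<Longrightarrow> inj_on (snd c) (fst c)"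
    and dom: "\<And>c. c \<in> A \<Longrightarrow> x \<in> fst c \<Longrightarrow> \<forall>\<^sub>F n in F. y n \<in> fst c"
    and lim: "\<And>c. c \<in> A \<Longrightarrow> x \<in> fst c \<Longrightarrow> ((\<lambda>n. snd c (y n)) \<longlongrightarrow> snd c x) F"
  shows "((\<lambda>n. f (y n)) \<longlongrightarrow> f x) F"
proof -
  obtain c d W where c: "c \<in> A" "x \<in> fst c" and d: "d \<in> B" and W: "snd c x \<in> W"
    "f ` chart_inv c ` W \<subseteq> fst d" and sm: "smooth_on W (local_rep c d f)"
    using f unfolding smooth_at_def by blast
  have inv: "chart_inv c (snd c z) = z" if "z \<in> fst c" for z
    using inj[OF c] that by (simp add: chart_inv_def)
  have fx: "f x \<in> fst d"
    using W inv[OF c(2)] by force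
  have cont: "isCont (local_rep c d f) (snd c x)"
    using smooth_onD[OF sm] W(1) continuous_on_eq_continuous_at by blast
  have rep: "((\<lambda>n. local_rep c d f (snd c (y n))) \<longlongrightarrow> local_rep c d f (snd c x)) F"
    using isCont_tendsto_compose[OF cont lim[OF c]] .
  have repx: "local_rep c d f (snd c x) = snd d (f x)"
    by (simp add: local_rep_def inv c)
  have "((\<lambda>n. chart_inv d (local_rep c d f (snd c (y n)))) \<longlongrightarrow> chart_inv d (snd d (f x))) F"
    using isCont_tendsto_compose[OF isCont_chart_inv[OF B d fx]] rep repx by simp
  moreover have "\<forall>\<^sub>F n in F. chart_inv d (local_rep c d f (snd c (y n))) = f (y n)"
  proof -
    have "\<forall>\<^sub>F n in F. snd c (y n) \<in> W"
      using lim[OF c] smooth_onD(1)[OF sm] W(1) by (simp add: topological_tendstoD)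
    then show ?thesis
      using dom[OF c]
    proof eventually_elim
      case (elim n)
      then have "f (y n) \<in> fst d" using W(2) inv[of "y n"] by force
      then show ?case
        by (simp add: local_rep_def inv elim chart_inv_chart[OF B d])
    qed
  qed
  ultimately show ?thesis
    using chart_inv_chart[OF B d fx] by (simp add: tendsto_cong)
qed

lemma smooth_at_isCont:
  assumes "smooth_manifold A" "smooth_manifold B" "smooth_at A B f x"
  shows "isCont f x"
proof -
  have "((\<lambda>y. f y) \<longlongrightarrow> f x) (nhds x)"
  proof (rule smooth_at_tendsto[OF assms(3,2)])
    fix c assume c: "c \<in> A" "x \<in> fst c"
    show "inj_on (snd c) (fst c)"
      using chart_inv_chart[OF assms(1) c(1)] by (rule inj_on_inverseI)
    show "\<forall>\<^sub>F y in nhds x. y \<in> fst c"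
      using open_chart_domain[OF assms(1) c(1)] c(2) by (rule eventually_nhds_in_open)
    show "((\<lambda>y. snd c y) \<longlongrightarrow> snd c x) (nhds x)"
      using isCont_chart[OF assms(1) c] by (simp add: isCont_def tendsto_at_iff_tendsto_nhds)
  qed
  then show ?thesis by (simp add: isCont_def tendsto_at_iff_tendsto_nhds)
qed

section \<open>The chain rule in charts\<close>

lemma local_rep_chart:
  assumes "smooth_manifold A" "c \<in> A" "x \<in> fst c"
  shows "local_rep c d f (snd c x) = snd d (f x)"
  by (simp add: local_rep_def chart_inv_chart[OF assms])

text \<open>The derivative of a local representative depends only on the germ of the map; stating the
  chain rule for any map with the germ of the composite covers local inverses as well.\<close>

lemma local_rep_has_derivative_compose:
  assumes A: "smooth_manifold A" "c \<in> A" "x \<in> fst c"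
    and B: "smooth_manifold B" "d \<in> B" "f x \<in> fst d"
    and f: "isCont f x" "(local_rep c d f has_derivative F) (at (snd c x))"
    and g: "(local_rep d e g has_derivative G) (at (snd d (f x)))"
    and h: "\<forall>\<^sub>F y in nhds x. h y = g (f y)"
  shows "(local_rep c e h has_derivative (G \<circ> F)) (at (snd c x))"
proof -
  have comp: "((local_rep d e g \<circ> local_rep c d f) has_derivative (G \<circ> F)) (at (snd c x))"
    using diff_chain_at[OF f(2)] g by (simp add: local_rep_chart[OF A])
  have "\<forall>\<^sub>F y in nhds x. f y \<in> fst d"
    using f(1) open_chart_domain[OF B(1,2)] B(3)
    by (simp add: isCont_def tendsto_at_iff_tendsto_nhds topological_tendstoD)
  then have "\<forall>\<^sub>F y in nhds x. f y \<in> fst d \<and> h y = g (f y)"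
    using h by eventually_elim simp
  from eventually_chart_inv[OF A this]
  have eq: "\<forall>\<^sub>F z in nhds (snd c x). (local_rep d e g \<circ> local_rep c d f) z = local_rep c e h z"
    by eventually_elim (auto simp: local_rep_def chart_inv_chart[OF B(1,2)])
  show ?thesis
    by (rule has_derivative_transform_eventually[OF comp])
      (use eq eventually_nhds_x_imp_x[OF eq] in \<open>auto simp: eventually_at_filter elim: eventually_mono\<close>)
qed

lemma transition_differentiable:
  assumes "smooth_manifold A" "c \<in> A" "d \<in> A" "x \<in> fst c" "x \<in> fst d"
  shows "local_rep c d id differentiable (at (snd c x))"
proof -
  have "smooth_on (snd c ` (fst c \<inter> fst d)) (local_rep c d id)"
    using assms unfolding smooth_manifold_def by blast
  then show ?thesis using smooth_onD(3) assms by blast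
qed

text \<open>The definition of \<open>smooth_at\<close> provides one favourable pair of charts, whereas the
  differential uses an arbitrary one. The two are related by composing with the changes of charts
  on both sides.\<close>

lemma smooth_at_differentiable:
  assumes A: "smooth_manifold A" "c \<in> A" "x \<in> fst c"
    and B: "smooth_manifold B" "d \<in> B" "f x \<in> fst d"
    and f: "smooth_at A B f x"
  shows "local_rep c d f differentiable (at (snd c x))"
proof -
  obtain c' d' W where c': "c' \<in> A" "x \<in> fst c'" and d': "d' \<in> B" and W: "snd c' x \<in> W"
    "f ` chart_inv c' ` W \<subseteq> fst d'" and sm: "smooth_on W (local_rep c' d' f)"
    using f unfolding smooth_at_def by blast
  have fx: "f x \<in> fst d'"
    using W chart_inv_chart[OF A(1) c'] by force
  have cont: "isCont f x" by (rule smooth_at_isCont[OF A(1) B(1) f])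
  obtain F where F: "(local_rep c' d' f has_derivative F) (at (snd c' x))"
    using smooth_onD(3)[OF sm W(1)] unfolding differentiable_def by blast
  obtain G where G: "(local_rep d' d id has_derivative G) (at (snd d' (f x)))"
    using transition_differentiable[OF B(1) d' B(2) fx B(3)] unfolding differentiable_def by blast
  obtain H where H: "(local_rep c c' id has_derivative H) (at (snd c x))"
    using transition_differentiable[OF A(1,2) c'(1) A(3) c'(2)] unfolding differentiable_def by blast
  have "(local_rep c' d f has_derivative (G \<circ> F)) (at (snd c' x))"
    by (rule local_rep_has_derivative_compose[OF A(1) c' B(1) d' fx cont F G]) simp
  then have "(local_rep c d f has_derivative ((G \<circ> F) \<circ> H)) (at (snd c x))"
    by (intro local_rep_has_derivative_compose[OF A A(1) c'(1) _ _ H, where g=f]) (auto simp: c')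
  then show ?thesis unfolding differentiable_def by blast
qed

lemma transition_derivative_self:
  assumes "smooth_manifold A" "c \<in> A" "x \<in> fst c"
  shows "(local_rep c c id has_derivative (\<lambda>w. w)) (at (snd c x))"
proof (rule has_derivative_transform_within_open[OF has_derivative_ident])
  show "open (snd c ` fst c)" using open_chart_image[OF assms(1,2)] .
  show "snd c x \<in> snd c ` fst c" using assms by blast
  show "z = local_rep c c id z" if "z \<in> snd c ` fst c" for z
    using that by (auto simp: local_rep_def chart_inv_chart[OF assms(1,2)])
qed

text \<open>The cocycle identity for the derivatives of the changes of charts: it makes coordinates that
  are prescribed in one chart and transported to the others a tangent vector.\<close>

lemma transition_derivative_compose:
  assumes A: "smooth_manifold A" and c: "c \<in> A" "x \<in> fst c" and d: "d \<in> A" "x \<in> fst d"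
    and e: "e \<in> A" "x \<in> fst e"
  shows "frechet_derivative (local_rep d e id) (at (snd d x))
      (frechet_derivative (local_rep c d id) (at (snd c x)) w)
    = frechet_derivative (local_rep c e id) (at (snd c x)) w"
proof -
  let ?F = "frechet_derivative (local_rep c d id) (at (snd c x))"
  let ?G = "frechet_derivative (local_rep d e id) (at (snd d x))"
  have F: "(local_rep c d id has_derivative ?F) (at (snd c x))"
    using transition_differentiable[OF A c(1) d(1) c(2) d(2)] by (simp add: frechet_derivative_works)
  have G: "(local_rep d e id has_derivative ?G) (at (snd d x))"
    using transition_differentiable[OF A d(1) e(1) d(2) e(2)] by (simp add: frechet_derivative_works)
  have "(local_rep c e id has_derivative (?G \<circ> ?F)) (at (snd c x))"
    by (rule local_rep_has_derivative_compose[OF A c A d(1) _ _ F, where g=id]) (use d G in auto)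
  from frechet_derivative_at[OF this] show ?thesis by (metis comp_apply)
qed

lemma openin_atlas_topology_imp_open:
  assumes A: "smooth_manifold A" and U: "openin (atlas_topology A) U"
  shows "open U"
proof -
  have "generate_topology_on {fst c \<inter> snd c -` W | c W. c \<in> A \<and> open W} U"
    using openin_topology_generated_by U unfolding atlas_topology_def by blast
  then show ?thesis
  proof induction
    case (Basis S)
    then obtain c W where S: "S = fst c \<inter> snd c -` W" "c \<in> A" "open W" by blast
    then show ?case
      using continuous_open_preimage[OF continuous_on_chart[OF A S(2)] open_chart_domain[OF A S(2)]]
      by simp
  qed auto
qed

text \<open>Differentiating the two composites of \<open>f\<close> with its local inverse gives the two one-sided
  inverses of the derivative, so the model spaces need not be compared by dimension.\<close>

lemma local_diffeo_derivative_bij: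
  assumes A: "smooth_manifold A" "c \<in> A" "x \<in> fst c"
    and B: "smooth_manifold B" "d \<in> B" "f x \<in> fst d"
    and f: "local_diffeo_at A B f x"
  shows "bij (frechet_derivative (local_rep c d f) (at (snd c x)))"
proof -
  obtain U V where U: "openin (atlas_topology A) U" "x \<in> U" and V: "openin (atlas_topology B) V"
    and bij: "bij_betw f U V" and sf: "\<forall>y\<in>U. smooth_at A B f y"
    and sg: "\<forall>z\<in>V. smooth_at B A (inv_into U f) z"
    using f unfolding local_diffeo_at_def by blast
  define g where "g = inv_into U f"
  have gf: "g (f y) = y" if "y \<in> U" for y
    using that bij by (simp add: g_def bij_betw_def)
  have fg: "f (g z) = z" if "z \<in> V" for z
    using that bij by (simp add: g_def bij_betw_def f_inv_into_f)
  have fx: "f x \<in> V" using U(2) bij by (auto simp: bij_betw_def)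
  have gx: "g (f x) = x" using gf U(2) by simp
  have sfx: "smooth_at A B f x" and sgx: "smooth_at B A g (f x)"
    using sf sg U(2) fx by (auto simp: g_def)
  have cf: "isCont f x" and cg: "isCont g (f x)"
    using smooth_at_isCont A B sfx sgx by blast+
  let ?F = "frechet_derivative (local_rep c d f) (at (snd c x))"
  let ?G = "frechet_derivative (local_rep d c g) (at (snd d (f x)))"
  have F: "(local_rep c d f has_derivative ?F) (at (snd c x))"
    using smooth_at_differentiable[OF A B sfx] by (simp add: frechet_derivative_works)
  have G: "(local_rep d c g has_derivative ?G) (at (snd d (f x)))"
    using smooth_at_differentiable[OF B A(1,2) _ sgx] A(3) gx by (simp add: frechet_derivative_works)
  have evU: "\<forall>\<^sub>F y in nhds x. id y = g (f y)"
    using eventually_nhds_in_open[OF openin_atlas_topology_imp_open[OF A(1) U(1)] U(2)]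
    by eventually_elim (simp add: gf)
  have evV: "\<forall>\<^sub>F z in nhds (f x). id z = f (g z)"
    using eventually_nhds_in_open[OF openin_atlas_topology_imp_open[OF B(1) V] fx]
    by eventually_elim (simp add: fg)
  have "(local_rep c c id has_derivative (?G \<circ> ?F)) (at (snd c x))"
    by (rule local_rep_has_derivative_compose[OF A B cf F G evU])
  then have GF: "?G \<circ> ?F = (\<lambda>w. w)"
    using has_derivative_unique[OF _ transition_derivative_self[OF A]] by blast
  have "(local_rep d d id has_derivative (?F \<circ> ?G)) (at (snd d (f x)))"
    by (rule local_rep_has_derivative_compose[OF B A(1,2) _ cg G _ evV]) (use F gx A(3) in auto)
  then have FG: "?F \<circ> ?G = (\<lambda>w. w)"
    using has_derivative_unique[OF _ transition_derivative_self[OF B]] by blast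
  show ?thesis
    using GF FG o_bij[of ?G ?F] by (simp add: id_def)
qed

section \<open>Tangent vectors\<close>

text \<open>A tangent vector is determined by its coordinates in one chart, and every coordinate vector
  occurs, so that one chart suffices to compare or to construct tangent vectors.\<close>

lemma tangent_vector_eqI:
  assumes "u \<in> tangent_space A x" "v \<in> tangent_space A x" "c \<in> A" "x \<in> fst c" "u c = v c"
  shows "u = v"
proof
  fix d
  show "u d = v d"
  proof (cases "d \<in> A \<and> x \<in> fst d")
    case True
    with assms have
      "u d = frechet_derivative (local_rep c d id) (at (snd c x)) (u c)"
      "v d = frechet_derivative (local_rep c d id) (at (snd c x)) (v c)"
      unfolding tangent_space_def by blast+
    with assms show ?thesis by simp
  next
    case False
    with assms have "u d = 0" "v d = 0" unfolding tangent_space_def by blast+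
    then show ?thesis by simp
  qed
qed

lemma tangent_vector_exists:
  assumes A: "smooth_manifold A" and c: "c \<in> A" "x \<in> fst c"
  obtains v where "v \<in> tangent_space A x" "v c = w"
proof
  let ?v = "\<lambda>d. if d \<in> A \<and> x \<in> fst d
    then frechet_derivative (local_rep c d id) (at (snd c x)) w else 0"
  show "?v \<in> tangent_space A x"
    using transition_derivative_compose[OF A c] by (auto simp: tangent_space_def)
  show "?v c = w"
    using c frechet_derivative_at[OF transition_derivative_self[OF A c]] by (metis (no_types, lifting))
qed

lemma tscale_simps [simp]:
  "tscale t v c = t *\<^sub>R v c" "tscale 0 v = tzero" "tscale 1 v = v"
  by (auto simp: tscale_def tzero_def)

lemma tscale_in_tangent_space:
  assumes A: "smooth_manifold A" and v: "v \<in> tangent_space A x"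
  shows "tscale t v \<in> tangent_space A x"
proof -
  have "t *\<^sub>R v d = frechet_derivative (local_rep c d id) (at (snd c x)) (t *\<^sub>R v c)"
    if c: "c \<in> A" "x \<in> fst c" and d: "d \<in> A" "x \<in> fst d" for c d
  proof -
    have "linear (frechet_derivative (local_rep c d id) (at (snd c x)))"
      using transition_differentiable[OF A c(1) d(1) c(2) d(2)] by (rule linear_frechet_derivative)
    moreover have "v d = frechet_derivative (local_rep c d id) (at (snd c x)) (v c)"
      using v c d unfolding tangent_space_def by blast
    ultimately show ?thesis by (simp add: linear_scale)
  qed
  moreover have "t *\<^sub>R v c = 0" if "\<not> (c \<in> A \<and> x \<in> fst c)" for c
  proof -
    have "v c = 0" using v that unfolding tangent_space_def by blast
    then show ?thesis by simp
  qed
  ultimately show ?thesis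
    unfolding tangent_space_def tscale_simps by blast
qed

lemma continuous_map_tscale:
  assumes A: "smooth_manifold A" and v: "v \<in> tangent_space A x"
  shows "continuous_map euclidean (atlas_topology (tangent_space_atlas A x)) (\<lambda>t. tscale t v)"
  unfolding atlas_topology_def
proof (rule continuous_on_generated_topo)
  fix U assume "U \<in> {fst c \<inter> snd c -` W |c W. c \<in> tangent_space_atlas A x \<and> open W}"
  then obtain c W where U: "U = tangent_space A x \<inter> (\<lambda>v. v c) -` W" and W: "open W"
    unfolding tangent_space_atlas_def by auto
  have "(\<lambda>t. tscale t v) -` U = (\<lambda>t. t *\<^sub>R v c) -` W"
    using tscale_in_tangent_space[OF A v] by (auto simp: U)
  then show "openin euclidean ((\<lambda>t. tscale t v) -` U \<inter> topspace euclidean)"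
    using open_vimage[OF W, of "\<lambda>t. t *\<^sub>R v c"] by (simp add: continuous_intros)
next
  obtain c where c: "c \<in> A" "x \<in> fst c" using manifold_chart_exists[OF A] by blast
  then have "(tangent_space A x, \<lambda>v. v c) \<in> tangent_space_atlas A x"
    unfolding tangent_space_atlas_def by blast
  then have "\<exists>c' W. tangent_space A x = fst c' \<inter> snd c' -` W
      \<and> c' \<in> tangent_space_atlas A x \<and> open W"
    by (intro exI[of _ "(tangent_space A x, \<lambda>v. v c)"] exI[of _ UNIV]) simp
  then show "(\<lambda>t. tscale t v) ` topspace euclidean
      \<subseteq> \<Union>{fst c \<inter> snd c -` W |c W. c \<in> tangent_space_atlas A x \<and> open W}"
    using tscale_in_tangent_space[OF A v] by blast
qed

section \<open>The exponential map of an injective geodesic structure\<close>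

lemma injective_geodesic_structureD:
  assumes "injective_geodesic_structure A Exp"
  shows "smooth_manifold A"
    and "v \<in> tangent_space A x \<Longrightarrow> smooth_at (tangent_bundle_atlas A) A (\<lambda>(x, v). Exp x v) (x, v)"
    and "Exp x ` tangent_space A x = UNIV"
    and "open_map (atlas_topology (tangent_space_atlas A x)) euclidean (Exp x)"
    and "local_diffeo_at (tangent_space_atlas A x) A (Exp x) tzero"
  using assms
  unfolding injective_geodesic_structure_def geodesic_structure_def tangent_bundle_def by auto

lemma injective_geodesic_structure_segment_exists:
  assumes "injective_geodesic_structure A Exp"
  obtains \<gamma> where "geodesic_segment A Exp \<gamma>" "\<gamma> 0 = x" "\<gamma> 1 = y"
  using assms unfolding injective_geodesic_structure_def by blast

lemma injective_geodesic_structure_segment_unique: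
  assumes "injective_geodesic_structure A Exp"
    and "geodesic_segment A Exp \<gamma>" "geodesic_segment A Exp \<gamma>'" "\<gamma> 0 = \<gamma>' 0" "\<gamma> 1 = \<gamma>' 1" "t \<in> {0..1}"
  shows "\<gamma> t = \<gamma>' t"
  using assms unfolding injective_geodesic_structure_def by metis

text \<open>The value at \<open>t = 0\<close> of any segment starting at \<open>x\<close>, for instance the one from \<open>x\<close>
  to \<open>x\<close>.\<close>

lemma Exp_zero:
  assumes "injective_geodesic_structure A Exp"
  shows "Exp x tzero = x"
proof -
  obtain \<gamma> where \<gamma>: "geodesic_segment A Exp \<gamma>" "\<gamma> 0 = x"
    using injective_geodesic_structure_segment_exists[OF assms] by blast
  then obtain v where "\<forall>t\<in>{0..1}. \<gamma> t = Exp x (tscale t v)"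
    unfolding geodesic_segment_def by blast
  then have "\<gamma> 0 = Exp x (tscale 0 v)" by simp
  then show ?thesis using \<gamma>(2) by simp
qed

lemma geodesic_segment_Exp:
  assumes "injective_geodesic_structure A Exp" "v \<in> tangent_space A x"
  shows "geodesic_segment A Exp (\<lambda>t. Exp x (tscale t v))"
  using assms(2) by (auto simp: geodesic_segment_def Exp_zero[OF assms(1)])

text \<open>Uniqueness of segments extends an equality of \<open>exp\<^sub>x(u)\<close> and \<open>exp\<^sub>x(v)\<close> to all
  multiples by \<open>t \<in> [0,1]\<close>. For small \<open>t > 0\<close> the vectors \<open>tu\<close> and \<open>tv\<close> lie where
  \<open>exp\<^sub>x\<close> is injective, hence are equal.\<close>

lemma inj_on_Exp:
  assumes X: "injective_geodesic_structure A Exp"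
  shows "inj_on (Exp x) (tangent_space A x)"
proof (rule inj_onI)
  fix u v assume u: "u \<in> tangent_space A x" and v: "v \<in> tangent_space A x"
    and eq: "Exp x u = Exp x v"
  note A = injective_geodesic_structureD(1)[OF X]
  have same: "Exp x (tscale t u) = Exp x (tscale t v)" if "t \<in> {0..1}" for t
    using injective_geodesic_structure_segment_unique[OF X geodesic_segment_Exp[OF X u]
        geodesic_segment_Exp[OF X v] _ _ that] eq by simp
  obtain U where U: "openin (atlas_topology (tangent_space_atlas A x)) U" "tzero \<in> U"
    and inj: "inj_on (Exp x) U"
    using injective_geodesic_structureD(5)[OF X, of x]
    unfolding local_diffeo_at_def bij_betw_def by blast
  have small: "\<forall>\<^sub>F t in at_right 0. tscale t w \<in> U" if "w \<in> tangent_space A x" for w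
  proof -
    have "openin euclidean {t \<in> topspace euclidean. tscale t w \<in> U}"
      using openin_continuous_map_preimage[OF continuous_map_tscale[OF A that] U(1)] .
    then have "\<forall>\<^sub>F t in nhds 0. t \<in> {t. tscale t w \<in> U}"
      using U(2) by (intro eventually_nhds_in_open) auto
    then show ?thesis by (simp add: eventually_at_filter eventually_mono)
  qed
  have "\<forall>\<^sub>F t in at_right (0::real). t \<in> {0<..<1}"
    by (rule eventually_at_right_real) simp
  then have "\<forall>\<^sub>F t in at_right 0. tscale t u \<in> U \<and> tscale t v \<in> U \<and> t \<in> {0<..<1}"
    using small[OF u] small[OF v] by eventually_elim blast
  then obtain t where t: "tscale t u \<in> U" "tscale t v \<in> U" "0 < t" "t < 1"
    using eventually_happens[of _ "at_right (0::real)"] by auto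
  have "tscale t u = tscale t v"
    using inj_onD[OF inj same t(1,2)] t by simp
  then show "u = v"
    using t(3) by (auto simp: tscale_def fun_eq_iff)
qed

lemma Exp_tendsto:
  assumes X: "injective_geodesic_structure A Exp" and v: "v \<in> tangent_space A x"
    and w: "\<And>n. w n \<in> tangent_space A x"
    and lim: "\<And>c. c \<in> A \<Longrightarrow> x \<in> fst c \<Longrightarrow> ((\<lambda>n. w n c) \<longlongrightarrow> v c) F"
  shows "((\<lambda>n. Exp x (w n)) \<longlongrightarrow> Exp x v) F"
proof -
  note A = injective_geodesic_structureD(1)[OF X]
  have "((\<lambda>n. (\<lambda>(x, v). Exp x v) (x, w n)) \<longlongrightarrow> (\<lambda>(x, v). Exp x v) (x, v)) F"
  proof (rule smooth_at_tendsto[OF injective_geodesic_structureD(2)[OF X v] A])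
    fix c' assume "c' \<in> tangent_bundle_atlas A" "(x, v) \<in> fst c'"
    then obtain c where c: "c \<in> A" "x \<in> fst c"
      and c': "c' = (SIGMA x:fst c. tangent_space A x, \<lambda>(x, v). (snd c x, v c))"
      unfolding tangent_bundle_atlas_def by auto
    show "inj_on (snd c') (fst c')"
    proof (rule inj_onI)
      fix a b assume a: "a \<in> fst c'" and b: "b \<in> fst c'" and eq: "snd c' a = snd c' b"
      have "fst a = fst b"
        using a b eq chart_inv_chart[OF A c(1)] unfolding c' by (auto split: prod.splits) metis
      moreover have "snd a = snd b"
        using a b eq calculation tangent_vector_eqI[OF _ _ c(1), of "snd a" "fst a" "snd b"]
        unfolding c' by (auto split: prod.splits)
      ultimately show "a = b" by (rule prod_eqI)
    qed
    show "\<forall>\<^sub>F n in F. (x, w n) \<in> fst c'"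
      using w c by (simp add: c')
    show "((\<lambda>n. snd c' (x, w n)) \<longlongrightarrow> snd c' (x, v)) F"
      using tendsto_Pair[OF tendsto_const lim[OF c]] by (simp add: c')
  qed
  then show ?thesis by simp
qed

text \<open>Openness of the injective map \<open>exp\<^sub>x\<close> is continuity of its inverse.\<close>

lemma Exp_tendsto_imp_tendsto:
  assumes X: "injective_geodesic_structure A Exp" and v: "v \<in> tangent_space A x"
    and w: "\<And>n. w n \<in> tangent_space A x"
    and lim: "((\<lambda>n. Exp x (w n)) \<longlongrightarrow> Exp x v) F"
    and c: "c \<in> A" "x \<in> fst c"
  shows "((\<lambda>n. w n c) \<longlongrightarrow> v c) F"
proof (rule topological_tendstoI)
  fix W :: "'b set" assume W: "open W" "v c \<in> W"
  let ?O = "tangent_space A x \<inter> (\<lambda>v. v c) -` W"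
  have "(tangent_space A x, \<lambda>v. v c) \<in> tangent_space_atlas A x"
    using c unfolding tangent_space_atlas_def by blast
  then have "?O \<in> {fst c \<inter> snd c -` W | c W. c \<in> tangent_space_atlas A x \<and> open W}"
    using W(1) by force
  then have "openin (atlas_topology (tangent_space_atlas A x)) ?O"
    unfolding atlas_topology_def by (rule topology_generated_by_Basis)
  then have "open (Exp x ` ?O)"
    using injective_geodesic_structureD(4)[OF X, of x] unfolding open_map_def by simp
  then have "\<forall>\<^sub>F n in F. Exp x (w n) \<in> Exp x ` ?O"
    using topological_tendstoD[OF lim] v W(2) by blast
  then show "\<forall>\<^sub>F n in F. w n c \<in> W"
  proof eventually_elim
    case (elim n)
    then obtain u where u: "u \<in> ?O" "Exp x (w n) = Exp x u" by blast
    then have "w n = u"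
      using inj_onD[OF inj_on_Exp[OF X, of x]] w by blast
    then show ?case using u(1) by blast
  qed
qed

text \<open>If infinitely many segments left \<open>U\<close> at parameters \<open>t\<^sub>n \<in> K\<close>, a limit parameter \<open>s\<close> of
  the \<open>t\<^sub>n\<close> would give \<open>exp\<^sub>x(t\<^sub>nw\<^sub>n) \<rightarrow> exp\<^sub>x(sv) = \<gamma>(s) \<in> U\<close> along a subsequence, since
  the initial vectors \<open>w\<^sub>n\<close> converge to \<open>v\<close>.\<close>

lemma geodesic_segments_converge:
  assumes X: "injective_geodesic_structure A Exp"
    and g: "\<And>n. geodesic_segment A Exp (g n)" "\<And>n. g n 0 = x"
    and \<gamma>: "geodesic_segment A Exp \<gamma>" "\<gamma> 0 = x"
    and lim: "(\<lambda>n. g n 1) \<longlonglongrightarrow> \<gamma> 1"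
  shows "curves_converge g \<gamma>"
  unfolding curves_converge_def
proof (intro allI impI, elim conjE)
  fix K :: "real set" and U :: "'a set"
  assume K: "compact K" "K \<subseteq> {0..1}" and U: "open U" "\<gamma> ` K \<subseteq> U"
  note A = injective_geodesic_structureD(1)[OF X]
  obtain v where v: "v \<in> tangent_space A x"
    and \<gamma>v: "\<And>t. t \<in> {0..1} \<Longrightarrow> \<gamma> t = Exp x (tscale t v)"
    using \<gamma>(1) unfolding geodesic_segment_def \<gamma>(2) by blast
  have "\<forall>n. \<exists>w. w \<in> tangent_space A x \<and> (\<forall>t\<in>{0..1}. g n t = Exp x (tscale t w))"
    using g(1) unfolding geodesic_segment_def g(2) by blast
  then obtain w where w: "\<And>n. w n \<in> tangent_space A x"
    and gw: "\<And>n t. t \<in> {0..1} \<Longrightarrow> g n t = Exp x (tscale t (w n))"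
    by metis
  have "(\<lambda>n. Exp x (w n)) \<longlonglongrightarrow> Exp x v"
    using lim gw[of 1] \<gamma>v[of 1] by simp
  from Exp_tendsto_imp_tendsto[OF X v w this]
  have wlim: "(\<lambda>n. w n c) \<longlonglongrightarrow> v c" if "c \<in> A" "x \<in> fst c" for c
    using that by blast
  show "\<forall>\<^sub>F n in sequentially. g n ` K \<subseteq> U"
  proof (rule ccontr)
    assume "\<not> ?thesis"
    then have "\<exists>\<^sub>F n in sequentially. \<not> g n ` K \<subseteq> U"
      by (simp add: frequently_def)
    then have "infinite {n. \<not> g n ` K \<subseteq> U}"
      by (simp add: frequently_cofinite flip: cofinite_eq_sequentially)
    then obtain r :: "nat \<Rightarrow> nat" where r: "strict_mono r" "\<And>n. r n \<in> {n. \<not> g n ` K \<subseteq> U}"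
      using infinite_enumerate by blast
    then have "\<forall>n. \<exists>t. t \<in> K \<and> g (r n) t \<notin> U" by blast
    then obtain t where t: "\<And>n. t n \<in> K" "\<And>n. g (r n) (t n) \<notin> U" by metis
    obtain s and l where s: "s \<in> K" "strict_mono l" "(t \<circ> l) \<longlonglongrightarrow> s"
      using K(1) t(1) unfolding compact_def by metis
    have sub: "strict_mono (r \<circ> l)" using r(1) s(2) by (rule strict_mono_o)
    have "(\<lambda>n. Exp x (tscale (t (l n)) (w (r (l n))))) \<longlonglongrightarrow> Exp x (tscale s v)"
    proof (rule Exp_tendsto[OF X])
      fix c assume c: "c \<in> A" "x \<in> fst c"
      have "(\<lambda>n. w (r (l n)) c) \<longlonglongrightarrow> v c"
        using LIMSEQ_subseq_LIMSEQ[OF wlim[OF c] sub] by (simp add: o_def)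
      then show "(\<lambda>n. tscale (t (l n)) (w (r (l n))) c) \<longlonglongrightarrow> tscale s v c"
        using tendsto_scaleR[OF s(3)] by (simp add: o_def)
    qed (use tscale_in_tangent_space[OF A] v w in auto)
    moreover have "Exp x (tscale s v) \<in> U"
      using U(2) s(1) K(2) \<gamma>v[of s] by (metis image_subset_iff subsetD)
    ultimately have "\<forall>\<^sub>F n in sequentially. Exp x (tscale (t (l n)) (w (r (l n)))) \<in> U"
      using topological_tendstoD U(1) by blast
    then obtain n where "Exp x (tscale (t (l n)) (w (r (l n)))) \<in> U"
      using eventually_happens'[OF sequentially_bot] by blast
    moreover have "t (l n) \<in> {0..1}" using t(1) K(2) by blast
    ultimately show False using gw[of "t (l n)" "r (l n)"] t(2)[of "l n"] by simp
  qed
qed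

lemma geodesically_convex_UNIV:
  assumes X: "injective_geodesic_structure A Exp"
  shows "geodesically_convex A Exp UNIV"
  unfolding geodesically_convex_def
proof (intro conjI ballI allI impI)
  fix x y
  show "\<exists>\<gamma>. geodesic_segment A Exp \<gamma> \<and> \<gamma> 0 = x \<and> \<gamma> 1 = y \<and> \<gamma> ` {0..1} \<subseteq> UNIV"
    using injective_geodesic_structure_segment_exists[OF X] by blast
next
  fix x y g
  assume g: "(\<forall>n. geodesic_segment A Exp (g n) \<and> g n 0 = x) \<and> (\<lambda>n. g n 1) \<longlonglongrightarrow> y"
  obtain \<gamma> where \<gamma>: "geodesic_segment A Exp \<gamma>" "\<gamma> 0 = x" "\<gamma> 1 = y"
    using injective_geodesic_structure_segment_exists[OF X] by blast
  then have "curves_converge (g \<circ> id) \<gamma>"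
    using geodesic_segments_converge[OF X _ _ \<gamma>(1,2)] g by simp
  then show "\<exists>r \<gamma>. strict_mono r \<and> curves_converge (g \<circ> r) \<gamma> \<and>
      geodesic_segment A Exp \<gamma> \<and> \<gamma> 0 = x \<and> \<gamma> 1 = y \<and> (\<forall>t\<in>{0..<1}. \<gamma> t \<in> UNIV)"
    using \<gamma> strict_mono_id by blast
qed

section \<open>Developing the visible set\<close>

lemma visible_set_develops:
  assumes "v \<in> visible_set A Exp M' D p"
  shows "differential M' A D p v \<in> tangent_space A (D p)"
    and "D (cover_exp A Exp M' D p v) = Exp (D p) (differential M' A D p v)"
proof -
  let ?P = "\<lambda>\<gamma>. cover_geodesic_segment A Exp M' D \<gamma> \<and> \<gamma> 0 = p \<and> initial_vector A Exp M' D \<gamma> v"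
  have "\<exists>\<gamma>. ?P \<gamma>"
    using assms unfolding visible_set_def by (rule CollectD)
  moreover define \<gamma> where "\<gamma> = Eps ?P"
  ultimately have "?P \<gamma>" using someI_ex[of ?P] by (simp only:)
  then have start: "\<gamma> 0 = p" and init: "initial_vector A Exp M' D \<gamma> v" by simp_all
  obtain u where "u \<in> tangent_space A (D p)" "differential M' A D p v = u"
    and "\<forall>t\<in>{0..1}. D (\<gamma> t) = Exp (D p) (tscale t u)"
    using init unfolding initial_vector_def start by blast
  then have dev: "differential M' A D p v \<in> tangent_space A (D p)"
    "\<forall>t\<in>{0..1}. D (\<gamma> t) = Exp (D p) (tscale t (differential M' A D p v))"
    by simp_all
  show "differential M' A D p v \<in> tangent_space A (D p)" by (rule dev(1))
  have "D (\<gamma> 1) = Exp (D p) (tscale 1 (differential M' A D p v))"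
    using dev(2) by (rule bspec) simp
  then show "D (cover_exp A Exp M' D p v) = Exp (D p) (differential M' A D p v)"
    by (simp add: cover_exp_def \<gamma>_def)
qed

text \<open>In one pair of charts the differential is the derivative of the local representative, a
  bijection of the model spaces. The last hypothesis says that \<open>differential\<close> has tangent vectors
  as values; it holds by the chain rule for every smooth map, and for a developing map at a point
  from which every tangent vector is visible it is immediate from \<open>visible_set_develops\<close>.\<close>

lemma differential_bij_betw:
  assumes A: "smooth_manifold A" and B: "smooth_manifold B"
    and f: "local_diffeo_at A B f x"
    and tangent: "\<And>v. v \<in> tangent_space A x \<Longrightarrow> differential A B f x v \<in> tangent_space B (f x)"
  shows "bij_betw (differential A B f x) (tangent_space A x) (tangent_space B (f x))"
proof -
  define c where "c = (SOME c. c \<in> A \<and> x \<in> fst c)"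
  have c: "c \<in> A" "x \<in> fst c"
    using manifold_chart_exists[OF A, of x] someI_ex[of "\<lambda>c. c \<in> A \<and> x \<in> fst c"]
    unfolding c_def by blast+
  obtain d where d: "d \<in> B" "f x \<in> fst d"
    using manifold_chart_exists[OF B] by blast
  let ?F = "frechet_derivative (local_rep c d f) (at (snd c x))"
  have F: "bij ?F" by (rule local_diffeo_derivative_bij[OF A c B d f])
  have rep: "differential A B f x v d = ?F (v c)" for v
    using d by (simp add: differential_def c_def Let_def)
  show ?thesis
  proof (rule bij_betw_imageI)
    show "inj_on (differential A B f x) (tangent_space A x)"
      using tangent_vector_eqI[OF _ _ c] bij_is_inj[OF F] rep by (metis inj_onI injD)
    show "differential A B f x ` tangent_space A x = tangent_space B (f x)"
    proof
      show "differential A B f x ` tangent_space A x \<subseteq> tangent_space B (f x)"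
        using tangent by blast
      show "tangent_space B (f x) \<subseteq> differential A B f x ` tangent_space A x"
      proof
        fix u assume u: "u \<in> tangent_space B (f x)"
        obtain v where v: "v \<in> tangent_space A x" "v c = inv ?F (u d)"
          using tangent_vector_exists[OF A c] by blast
        then have "differential A B f x v d = u d"
          using rep surj_f_inv_f[OF bij_is_surj[OF F]] by simp
        then have "differential A B f x v = u"
          using tangent_vector_eqI[OF tangent[OF v(1)] u d] by blast
        then show "u \<in> differential A B f x ` tangent_space A x" using v(1) by blast
      qed
    qed
  qed
qed

theorem proposition2p16:
  fixes A :: "('x::{t2_space,second_countable_topology}, 'e::real_normed_vector) chart set"
    and Exp :: "'x \<Rightarrow> ('x, 'e) tvec \<Rightarrow> 'x"
    and M :: "('m::{t2_space,second_countable_topology}, 'f::real_normed_vector) chart set"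
    and M' :: "('u::{t2_space,second_countable_topology}, 'f) chart set"
    and \<pi> :: "'u \<Rightarrow> 'm"
    and D :: "'u \<Rightarrow> 'x"
    and p :: 'u
  assumes "injective_geodesic_structure A Exp"
    and "geodesic_manifold A M M' \<pi> D"
    and "visible_set A Exp M' D p = tangent_space M' p"
  shows "visible_convex A Exp M' D p (visible_set A Exp M' D p)"
proof -
  let ?V = "visible_set A Exp M' D p" and ?exp = "cover_exp A Exp M' D p"
  let ?dD = "differential M' A D p"
  note X = assms(1)
  have M': "smooth_manifold M'" and D: "local_diffeo_at M' A D p"
    using assms(2) unfolding geodesic_manifold_def universal_cover_def by simp_all
  have tangent: "?dD v \<in> tangent_space A (D p)" if "v \<in> tangent_space M' p" for v
    using visible_set_develops(1)[OF that[folded assms(3)]] .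
  have bij: "bij_betw ?dD ?V (tangent_space A (D p))"
    unfolding assms(3)
    using differential_bij_betw[OF M' injective_geodesic_structureD(1)[OF X] D tangent] .
  have "bij_betw (Exp (D p)) (tangent_space A (D p)) UNIV"
    using inj_on_Exp[OF X] injective_geodesic_structureD(3)[OF X] by (simp add: bij_betw_def)
  then have "bij_betw (Exp (D p) \<circ> ?dD) ?V UNIV"
    using bij by (rule bij_betw_trans[rotated])
  then have dev: "bij_betw (D \<circ> ?exp) ?V UNIV"
    by (rule bij_betw_cong[THEN iffD1, rotated]) (simp add: visible_set_develops(2))
  then have "D ` ?exp ` ?V = UNIV"
    by (simp add: bij_betw_def image_comp)
  moreover have "inj_on D (?exp ` ?V)"
    using dev by (simp add: bij_betw_def inj_on_imageI)
  ultimately show ?thesis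
    using geodesically_convex_UNIV[OF X]
    unfolding visible_convex_def cover_convex_def by simp
qed

end
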